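(* Let $n\ge d\ge 3$ be integers. Then the set $\mathcal{E}_{n,d}=\operatorname{conv}E_{n,d}\subset\mathbb{R}^{d-1}$ is the image of the cyclic polytope $C(n,d-1)$ under an invertible affine linear map, and it is the convex hull of the points $(e_2,\dots,e_d)(\overline{k})=\left(\binom{k}{2}\frac1{k^2},\dots,\binom{k}{d}\frac1{k^d}\right)$ for $k\in\{1,\dots,n\}$.
   Context: $\Delta_{n-1}=\{x\in\mathbb{R}^n_{\geq 0}: x_1+\dots+x_n=1\}$; $e_k(x)=\sum_{I\subset\{1,\dots,n\},|I|=k}\prod_{i\in I}x_i$; $E_{n,d}=(e_2,\dots,e_d)(\Delta_{n-1})\subset\mathbb{R}^{d-1}$. For $1\le k\le n$, $\overline{k}=(0,\dots,0,\frac1k,\dots,\frac1k)\in\Delta_{n-1}$ with exactly $k$ entries equal to $\frac1k$. The cyclic polytope is realized as $C(n,d-1)=\operatorname{conv}\{(\frac1k,\frac1{k^2},\dots,\frac1{k^{d-1}}):1\le k\le n\}$. *)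

theory Defs
  imports "HOL-Analysis.Analysis"
begin

text \<open>
  Points of the simplex are functions on \<open>{1..n}\<close>, extended by 0 outside, so that \<open>n\<close> is an
  ordinary natural number. The target space \<open>\<real>\<^sup>d\<^sup>-\<^sup>1\<close> is \<open>real ^ 'm\<close> with \<open>CARD('m) = d - 1\<close>, where
  the linear order on \<open>'m\<close> says which coordinate is the first, the second, and so on.
\<close>

definition coord_num :: "'m::{finite,linorder} \<Rightarrow> nat" where
  "coord_num i = card {j. j \<le> i}"

lemma bij_betw_coord_num:
  "bij_betw (coord_num :: 'm::{finite,linorder} \<Rightarrow> nat) UNIV {1..CARD('m)}"
proof -
  have mono: "coord_num i < coord_num j" if "i < j" for i j :: 'm
  proof -
    have "{k. k \<le> i} \<subset> {k. k \<le> j}"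
    proof (rule psubsetI)
      show "{k. k \<le> i} \<subseteq> {k. k \<le> j}" using that by auto
      show "{k. k \<le> i} \<noteq> {k. k \<le> j}" using that by (metis leD mem_Collect_eq order_refl)
    qed
    then show ?thesis
      unfolding coord_num_def by (rule psubset_card_mono[OF finite])
  qed
  have inj: "inj (coord_num :: 'm \<Rightarrow> nat)"
    by (rule injI) (metis mono less_irrefl linorder_neqE)
  have sub: "range (coord_num :: 'm \<Rightarrow> nat) \<subseteq> {1..CARD('m)}"
  proof (rule image_subsetI)
    fix i :: 'm
    have "card {i} \<le> card {j. j \<le> i}"
      by (rule card_mono[OF finite]) auto
    moreover have "card {j. j \<le> i} \<le> CARD('m)"
      by (rule card_mono[OF finite]) auto
    ultimately show "coord_num i \<in> {1..CARD('m)}" by (simp add: coord_num_def)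
  qed
  have "card (range (coord_num :: 'm \<Rightarrow> nat)) = card {1..CARD('m)}"
    using inj by (simp add: card_image)
  then have "range (coord_num :: 'm \<Rightarrow> nat) = {1..CARD('m)}"
    using sub by (intro card_subset_eq) auto
  with inj show ?thesis by (simp add: bij_betw_def)
qed

definition prob_simplex :: "nat \<Rightarrow> (nat \<Rightarrow> real) set" where
  "prob_simplex n =
     {x. (\<forall>i\<in>{1..n}. 0 \<le> x i) \<and> (\<forall>i. i \<notin> {1..n} \<longrightarrow> x i = 0) \<and> (\<Sum>i=1..n. x i) = 1}"

definition elem_sym :: "nat \<Rightarrow> nat \<Rightarrow> (nat \<Rightarrow> real) \<Rightarrow> real" where
  "elem_sym n k x = (\<Sum>I | I \<subseteq> {1..n} \<and> card I = k. \<Prod>i\<in>I. x i)"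

text \<open>The map \<open>(e\<^sub>2, \<dots>, e\<^sub>d)\<close>: its first coordinate is \<open>e\<^sub>2\<close>, hence the shift by one.\<close>

definition elem_sym_map :: "nat \<Rightarrow> (nat \<Rightarrow> real) \<Rightarrow> real ^ 'm::{finite,linorder}" where
  "elem_sym_map n x = (\<chi> i. elem_sym n (coord_num i + 1) x)"

definition sym_image :: "nat \<Rightarrow> (real ^ 'm::{finite,linorder}) set" where
  "sym_image n = elem_sym_map n ` prob_simplex n"

text \<open>\<open>(0, \<dots>, 0, 1/k, \<dots>, 1/k)\<close>; truncated subtraction is harmless, as only \<open>k \<le> n\<close> is used.\<close>

definition bar_point :: "nat \<Rightarrow> nat \<Rightarrow> nat \<Rightarrow> real" where
  "bar_point n k = (\<lambda>i. if n - k < i \<and> i \<le> n then 1 / real k else 0)"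

definition cyclic_polytope :: "nat \<Rightarrow> (real ^ 'm::{finite,linorder}) set" where
  "cyclic_polytope n = convex hull ((\<lambda>k. \<chi> i. 1 / real k ^ coord_num i) ` {1..n})"

definition invertible_affine_map :: "('a::real_vector \<Rightarrow> 'b::real_vector) \<Rightarrow> bool" where
  "invertible_affine_map f \<longleftrightarrow> (\<exists>L b. linear L \<and> bij L \<and> f = (\<lambda>x. L x + b))"

end

theory Submission
  imports Defs "HOL-Computational_Algebra.Polynomial"
begin

text \<open>
  The convex hull of \<open>(e\<^sub>2, \<dots>, e\<^sub>d)\<close> on the simplex is determined by the maxima of linear
  functionals, that is, of functions \<open>f = a\<^sub>2 e\<^sub>2 + \<dots> + a\<^sub>d e\<^sub>d\<close>. Each \<open>e\<^sub>k\<close> is symmetric and has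
  degree at most one in each variable. So if only \<open>x\<^sub>i\<close> and \<open>x\<^sub>j\<close> vary and \<open>x\<^sub>i + x\<^sub>j\<close> is fixed, then
  \<open>f = A + B x\<^sub>i x\<^sub>j\<close> (\<open>elem_sym_two_variables\<close>). This product is largest when the two entries are
  equal and zero when one of them vanishes. Consequently a maximiser of \<open>f\<close> with as few nonzero
  entries as possible has all its nonzero entries equal (\<open>maximum_at_uniform_point\<close>). Up to the
  order of the coordinates it is one of the points \<open>(0, \<dots>, 0, 1/k, \<dots>, 1/k)\<close>, and \<open>f\<close> is
  symmetric. By separation, the hull is spanned by the images of these points.

  The image of the \<open>k\<close>-th point has the coordinates \<open>(k choose (i + 1)) / k^(i + 1)\<close>. After
  cancelling powers of \<open>k\<close> such a coordinate is a polynomial of degree exactly \<open>i\<close> in \<open>1/k\<close>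
  (\<open>poly_bar_poly\<close>). It is therefore obtained from the vertex \<open>(1/k, 1/k\<^sup>2, \<dots>)\<close> of the cyclic
  polytope by an affine map whose linear part is triangular with nonzero diagonal. The map is the
  same for every \<open>k\<close>, so it carries the cyclic polytope onto the hull.
\<close>

section \<open>Elementary symmetric functions\<close>

text \<open>
  Splitting the index sets \<open>I\<close> by whether they contain \<open>a\<close> isolates the dependence of the sum on
  the single variable \<open>x a\<close>.
\<close>

lemma sum_prod_subsets_insert:
  fixes x :: "'a \<Rightarrow> 'b::comm_semiring_1"
  assumes "finite S" "a \<notin> S"
  shows "(\<Sum>I | I \<subseteq> insert a S \<and> card I = Suc k. \<Prod>i\<in>I. x i) =
    (\<Sum>I | I \<subseteq> S \<and> card I = Suc k. \<Prod>i\<in>I. x i) +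
    x a * (\<Sum>I | I \<subseteq> S \<and> card I = k. \<Prod>i\<in>I. x i)"
proof -
  let ?A = "{I. I \<subseteq> S \<and> card I = Suc k}" and ?B = "{I. I \<subseteq> S \<and> card I = k}"
  have fin: "finite I" "a \<notin> I" if "I \<subseteq> S" for I
    using that assms finite_subset by auto
  have "{I. I \<subseteq> insert a S \<and> card I = Suc k} = ?A \<union> insert a ` ?B" (is "?L = ?R")
  proof
    show "?R \<subseteq> ?L" using fin by (auto simp: card_insert_if)
    show "?L \<subseteq> ?R"
    proof
      fix I assume I: "I \<in> ?L"
      show "I \<in> ?R"
      proof (cases "a \<in> I")
        case True
        then have "I = insert a (I - {a})" "I - {a} \<in> ?B" using I by auto
        then show ?thesis by blast
      qed (use I in auto)
    qed
  qed
  moreover have "finite ?A" "finite ?B"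
    using assms by auto
  moreover have "?A \<inter> insert a ` ?B = {}"
    using assms by auto
  moreover have "inj_on (insert a) ?B"
    using assms by (auto simp: inj_on_def)
  moreover have "(\<Sum>I\<in>?B. \<Prod>i\<in>insert a I. x i) = x a * (\<Sum>I\<in>?B. \<Prod>i\<in>I. x i)"
    unfolding sum_distrib_left by (rule sum.cong) (use fin in auto)
  ultimately show ?thesis
    by (simp add: sum.union_disjoint sum.reindex)
qed

text \<open>
  The coefficients do not depend on \<open>u\<close> and \<open>v\<close>: they are the elementary symmetric functions of the
  other variables, of degrees \<open>k + 2\<close>, \<open>k + 1\<close> and \<open>k\<close>.
\<close>

lemma elem_sym_two_variables:
  assumes "i \<in> {1..n}" "j \<in> {1..n}" "i \<noteq> j"
  shows "\<exists>A B C. \<forall>u v. elem_sym n (Suc (Suc k)) (x(i := u, j := v)) = A + (u + v) * B + u * v * C"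
proof -
  let ?S = "{1..n} - {i, j}"
  define e where "e k = (\<Sum>I | I \<subseteq> ?S \<and> card I = k. \<Prod>l\<in>I. x l)" for k
  have e: "(\<Sum>I | I \<subseteq> ?S \<and> card I = k. \<Prod>l\<in>I. (x(i := u, j := v)) l) = e k" for k u v
    unfolding e_def by (intro sum.cong prod.cong refl) auto
  have S: "{1..n} = insert i (insert j ?S)" using assms by auto
  have "elem_sym n (Suc (Suc k)) (x(i := u, j := v)) =
      e (Suc (Suc k)) + (u + v) * e (Suc k) + u * v * e k" for u v
    unfolding elem_sym_def
    apply (subst S, subst sum_prod_subsets_insert)
      apply (use assms in auto)[2]
    apply (subst sum_prod_subsets_insert, simp, simp)+
    apply (simp only: e)
    using assms by (simp add: algebra_simps)
  then show ?thesis by blast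
qed

text \<open>
  The value depends only on how many entries are nonzero. This replaces an appeal to the invariance
  of \<open>e\<^sub>k\<close> under permutations, and it also evaluates \<open>e\<^sub>k\<close> at the points \<open>bar_point n k\<close>.
\<close>

lemma elem_sym_constant_on:
  assumes "S \<subseteq> {1..n}"
  shows "elem_sym n k (\<lambda>i. if i \<in> S then c else 0) = real (card S choose k) * c ^ k"
proof -
  have finS: "finite S" using assms finite_subset by blast
  have "elem_sym n k (\<lambda>i. if i \<in> S then c else 0) =
      (\<Sum>I | I \<subseteq> S \<and> card I = k. \<Prod>i\<in>I. if i \<in> S then c else 0)"
    unfolding elem_sym_def
  proof (rule sum.mono_neutral_right)
    show "\<forall>I\<in>{I. I \<subseteq> {1..n} \<and> card I = k} - {I. I \<subseteq> S \<and> card I = k}.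
        (\<Prod>i\<in>I. if i \<in> S then c else 0) = 0"
      by (auto intro!: prod_zero intro: finite_subset)
  qed (use assms in auto)
  also have "\<dots> = (\<Sum>I | I \<subseteq> S \<and> card I = k. c ^ k)"
  proof (rule sum.cong)
    fix I assume I: "I \<in> {I. I \<subseteq> S \<and> card I = k}"
    then have "(\<Prod>i\<in>I. if i \<in> S then c else 0) = (\<Prod>i\<in>I. c)"
      by (intro prod.cong) auto
    then show "(\<Prod>i\<in>I. if i \<in> S then c else 0) = c ^ k" using I by simp
  qed simp
  finally show ?thesis using n_subsets[OF finS] by simp
qed

section \<open>Maximisation over the simplex\<close>

text \<open>
  Functions on all of \<open>nat\<close> carry the product topology, so compactness comes from Tychonoff's theorem
  applied to a box that is degenerate outside \<open>{1..n}\<close>.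
\<close>

lemma compact_prob_simplex: "compact (prob_simplex n)"
proof -
  let ?B = "\<lambda>i. if i \<in> {1..n} then {0..1} else {0::real}"
  have "compact (PiE UNIV ?B)"
  proof -
    have "compactin (product_topology (\<lambda>i::nat. euclidean) UNIV) (PiE UNIV ?B)"
      by (subst compactin_PiE) auto
    then show ?thesis by (simp add: euclidean_product_topology)
  qed
  moreover have "closed {x::nat \<Rightarrow> real. (\<Sum>i=1..n. x i) = 1}"
    by (intro closed_Collect_eq continuous_intros continuous_on_product_coordinates)
  moreover have "prob_simplex n = PiE UNIV ?B \<inter> {x. (\<Sum>i=1..n. x i) = 1}" (is "_ = ?R")
  proof
    show "?R \<subseteq> prob_simplex n"
    proof
      fix x assume x: "x \<in> ?R"
      then have "x i \<in> ?B i" for i using PiE_mem[of x UNIV ?B i] by blast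
      then have "0 \<le> x i" "i \<notin> {1..n} \<Longrightarrow> x i = 0" for i
        by (metis atLeastAtMost_iff order_refl singletonD)+
      then show "x \<in> prob_simplex n" using x by (auto simp: prob_simplex_def)
    qed
    show "prob_simplex n \<subseteq> ?R"
    proof
      fix x assume x: "x \<in> prob_simplex n"
      have "x i \<le> 1" if "i \<in> {1..n}" for i
        using x member_le_sum[of i "{1..n}" x] that by (auto simp: prob_simplex_def)
      then show "x \<in> ?R" using x by (auto simp: prob_simplex_def)
    qed
  qed
  ultimately show ?thesis by (simp add: compact_Int_closed)
qed

lemma uniform_in_prob_simplex:
  assumes "S \<subseteq> {1..n}" "S \<noteq> {}"
  shows "(\<lambda>i. if i \<in> S then 1 / real (card S) else 0) \<in> prob_simplex n"
proof -
  have "finite S" using assms finite_subset by blast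
  moreover have "{1..n} \<inter> S = S" using assms by auto
  ultimately show ?thesis
    using assms by (auto simp: prob_simplex_def sum.If_cases)
qed

lemma prob_simplex_update2:
  assumes "x \<in> prob_simplex n" "i \<in> {1..n}" "j \<in> {1..n}" "i \<noteq> j"
    and "0 \<le> u" "0 \<le> v" "u + v = x i + x j"
  shows "x(i := u, j := v) \<in> prob_simplex n"
proof -
  have split: "(\<Sum>l=1..n. y l) = y i + (y j + (\<Sum>l\<in>{1..n} - {i} - {j}. y l))" for y :: "nat \<Rightarrow> real"
    using assms by (subst sum.remove[of _ i], simp, simp, subst sum.remove[of _ j]) auto
  have "(\<Sum>l\<in>{1..n} - {i} - {j}. (x(i := u, j := v)) l) = (\<Sum>l\<in>{1..n} - {i} - {j}. x l)"
    by (rule sum.cong) auto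
  then have "(\<Sum>l=1..n. (x(i := u, j := v)) l) = (\<Sum>l=1..n. x l)"
    unfolding split[of "x(i := u, j := v)"] split[of x] using assms by simp
  then show ?thesis using assms by (auto simp: prob_simplex_def)
qed

text \<open>
  Among the maximisers of \<open>f\<close>, which exist by compactness, take one with the fewest nonzero entries.
  If two of its nonzero entries differed, consider the coefficient \<open>B\<close> of their product. Moving
  all their mass to one of them makes the product 0, so maximality gives \<open>B \<ge> 0\<close>; and \<open>B = 0\<close> would
  give a maximiser with fewer nonzero entries. But if \<open>B > 0\<close>, averaging the two entries increases
  their product and hence \<open>f\<close>.
\<close>

lemma maximum_at_uniform_point:
  fixes f :: "(nat \<Rightarrow> real) \<Rightarrow> real"
  assumes n: "1 \<le> n"
    and cont: "continuous_on (prob_simplex n) f"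
    and pair: "\<And>x i j. x \<in> prob_simplex n \<Longrightarrow> i \<in> {1..n} \<Longrightarrow> j \<in> {1..n} \<Longrightarrow> i \<noteq> j \<Longrightarrow>
      \<exists>A B. \<forall>u v. u + v = x i + x j \<longrightarrow> f (x(i := u, j := v)) = A + B * (u * v)"
  obtains S where "S \<subseteq> {1..n}" "S \<noteq> {}"
    "\<And>x. x \<in> prob_simplex n \<Longrightarrow> f x \<le> f (\<lambda>i. if i \<in> S then 1 / real (card S) else 0)"
proof -
  define supp where "supp x = {i\<in>{1..n}. x i \<noteq> 0}" for x :: "nat \<Rightarrow> real"
  define is_max where "is_max x \<longleftrightarrow> x \<in> prob_simplex n \<and> (\<forall>y\<in>prob_simplex n. f y \<le> f x)" for x
  have "prob_simplex n \<noteq> {}"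
    using uniform_in_prob_simplex[of "{1..n}" n] n by auto
  then have "\<exists>x. is_max x"
    unfolding is_max_def using continuous_attains_sup[OF compact_prob_simplex _ cont] by blast
  then obtain x where x: "is_max x" and least: "\<And>y. is_max y \<Longrightarrow> card (supp x) \<le> card (supp y)"
    using exists_least_iff[of "\<lambda>k. \<exists>y. is_max y \<and> card (supp y) = k"]
    by (metis not_le)
  have xs: "x \<in> prob_simplex n" using x by (simp add: is_max_def)
  have fin: "finite (supp y)" for y by (simp add: supp_def)
  have equal: "x i = x j" if ij: "i \<in> supp x" "j \<in> supp x" for i j
  proof (rule ccontr)
    assume ne: "x i \<noteq> x j"
    have mem: "i \<in> {1..n}" "j \<in> {1..n}" "i \<noteq> j" using ij ne by (auto simp: supp_def)
    have pos: "0 < x i" "0 < x j"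
      using ij xs by (force simp: supp_def prob_simplex_def)+
    obtain A B where AB: "\<And>u v. u + v = x i + x j \<Longrightarrow> f (x(i := u, j := v)) = A + B * (u * v)"
      using pair[OF xs mem] by blast
    have fx: "f x = A + B * (x i * x j)" using AB[of "x i" "x j"] by simp
    \<comment> \<open>\<open>?z\<close> merges the two entries, and \<open>?h\<close> is their average\<close>
    let ?z = "x(i := x i + x j, j := 0)"
    let ?h = "(x i + x j) / 2"
    have z: "?z \<in> prob_simplex n"
      using prob_simplex_update2[OF xs mem] pos by simp
    have fz: "f ?z = A" using AB[of "x i + x j" 0] by simp
    have "B * (x i * x j) \<ge> 0" using x z fz fx by (force simp: is_max_def)
    moreover have "x i * x j > 0" using pos by simp
    ultimately have "B \<ge> 0" using zero_le_mult_iff by force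
    moreover have "B \<noteq> 0"
    proof
      assume "B = 0"
      then have "is_max ?z" using x z fz fx by (simp add: is_max_def)
      then have "card (supp x) \<le> card (supp ?z)" by (rule least)
      moreover have "supp ?z \<subset> supp x" using ij mem by (auto simp: supp_def)
      ultimately show False using psubset_card_mono[OF fin] by (metis not_le)
    qed
    moreover have "A + B * (?h * ?h) \<le> f x"
    proof -
      have "x(i := ?h, j := ?h) \<in> prob_simplex n"
        by (rule prob_simplex_update2[OF xs mem]) (use pos in auto)
      moreover have "f (x(i := ?h, j := ?h)) = A + B * (?h * ?h)" by (rule AB) simp
      ultimately show ?thesis using x by (metis is_max_def)
    qed
    ultimately have "?h * ?h \<le> x i * x j" using fx by simp
    moreover have "?h * ?h - x i * x j = ((x i - x j) / 2)\<^sup>2"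
      by (simp add: power2_eq_square field_simps)
    moreover have "((x i - x j) / 2)\<^sup>2 > 0" using ne by simp
    ultimately show False by linarith
  qed
  have total: "(\<Sum>i\<in>supp x. x i) = 1"
  proof -
    have "(\<Sum>i\<in>supp x. x i) = (\<Sum>i=1..n. x i)"
      by (rule sum.mono_neutral_left) (auto simp: supp_def)
    then show ?thesis using xs by (simp add: prob_simplex_def)
  qed
  have val: "x i = 1 / real (card (supp x))" if "i \<in> supp x" for i
  proof -
    have "(\<Sum>j\<in>supp x. x j) = (\<Sum>j\<in>supp x. x i)" by (intro sum.cong refl equal that)
    then have "real (card (supp x)) * x i = 1" using total by simp
    then show ?thesis by (auto simp: eq_divide_eq mult.commute)
  qed
  have "x = (\<lambda>i. if i \<in> supp x then 1 / real (card (supp x)) else 0)"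
  proof
    fix i
    show "x i = (if i \<in> supp x then 1 / real (card (supp x)) else 0)"
      using val[of i] xs by (auto simp: supp_def prob_simplex_def)
  qed
  moreover have "supp x \<noteq> {}" using total by auto
  moreover have "supp x \<subseteq> {1..n}" by (auto simp: supp_def)
  ultimately show thesis
    using that[of "supp x"] x by (auto simp: is_max_def)
qed

section \<open>The convex hull of the image\<close>

lemma coord_num_ge_1: "1 \<le> coord_num i"
  using bij_betw_coord_num by (force simp: bij_betw_def)

lemma bar_point_eq: "bar_point n k = (\<lambda>i. if i \<in> {n - k<..n} then 1 / real k else 0)"
  by (auto simp: bar_point_def)

lemma elem_sym_map_uniform:
  assumes "S \<subseteq> {1..n}"
  shows "(elem_sym_map n (\<lambda>i. if i \<in> S then 1 / real (card S) else 0) :: real ^ 'm::{finite,linorder}) =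
    (\<chi> i. real (card S choose (coord_num i + 1)) * (1 / real (card S) ^ (coord_num i + 1)))"
  using elem_sym_constant_on[OF assms]
  by (simp add: elem_sym_map_def vec_eq_iff power_one_over)

lemma elem_sym_map_bar_point:
  assumes "k \<in> {1..n}"
  shows "(elem_sym_map n (bar_point n k) :: real ^ 'm::{finite,linorder}) =
    (\<chi> i. real (k choose (coord_num i + 1)) * (1 / real k ^ (coord_num i + 1)))"
proof -
  have sub: "{n - k<..n} \<subseteq> {1..n}" and card: "card {n - k<..n} = k" using assms by auto
  show ?thesis unfolding bar_point_eq by (rule elem_sym_map_uniform[OF sub, unfolded card])
qed

text \<open>
  Every component of \<open>elem_sym_map\<close> has degree at least 2, so a linear functional of it has the form
  required by \<open>maximum_at_uniform_point\<close>: on a line where \<open>u + v\<close> is constant, the linear terms of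
  \<open>elem_sym_two_variables\<close> merge into the constant \<open>A\<close>.
\<close>

lemma linear_functional_max_at_bar_point:
  fixes a :: "real ^ 'm::{finite,linorder}"
  assumes "1 \<le> n"
  shows "\<exists>k\<in>{1..n}. \<forall>x\<in>prob_simplex n. a \<bullet> elem_sym_map n x \<le> a \<bullet> elem_sym_map n (bar_point n k)"
proof -
  let ?f = "\<lambda>x. a \<bullet> elem_sym_map n x"
  have f: "?f x = (\<Sum>i\<in>UNIV. a $ i * elem_sym n (coord_num i + 1) x)" for x
    by (simp add: inner_vec_def elem_sym_map_def)
  have cont: "continuous_on (prob_simplex n) ?f"
    unfolding f elem_sym_def
    by (intro continuous_intros continuous_on_subset[OF continuous_on_product_coordinates]) auto
  have pair: "\<exists>A B. \<forall>u v. u + v = x i + x j \<longrightarrow> ?f (x(i := u, j := v)) = A + B * (u * v)"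
    if "i \<in> {1..n}" "j \<in> {1..n}" "i \<noteq> j" for x i j
  proof -
    have "\<exists>A B C. \<forall>u v. elem_sym n (coord_num l + 1) (x(i := u, j := v)) = A + (u + v) * B + u * v * C"
      for l :: 'm
    proof -
      have "coord_num l + 1 = Suc (Suc (coord_num l - 1))" using coord_num_ge_1[of l] by simp
      then show ?thesis using elem_sym_two_variables[OF that] by metis
    qed
    then obtain A B C where ABC:
      "\<And>(l::'m) u v. elem_sym n (coord_num l + 1) (x(i := u, j := v)) = A l + (u + v) * B l + u * v * C l"
      by metis
    have "?f (x(i := u, j := v)) =
        (\<Sum>l\<in>UNIV. a $ l * (A l + (x i + x j) * B l)) + (\<Sum>l\<in>UNIV. a $ l * C l) * (u * v)"
      if "u + v = x i + x j" for u v
      unfolding f ABC that sum_distrib_right sum.distrib[symmetric]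
      by (rule sum.cong) (auto simp: algebra_simps)
    then show ?thesis by blast
  qed
  obtain S where S: "S \<subseteq> {1..n}" "S \<noteq> {}"
    "\<And>x. x \<in> prob_simplex n \<Longrightarrow> ?f x \<le> ?f (\<lambda>i. if i \<in> S then 1 / real (card S) else 0)"
    using maximum_at_uniform_point[OF assms cont pair] by blast
  have "finite S" using S finite_subset by blast
  then have k: "card S \<in> {1..n}"
    using S card_mono[OF _ S(1)] by (auto simp: Suc_le_eq card_gt_0_iff)
  have "(elem_sym_map n (\<lambda>i. if i \<in> S then 1 / real (card S) else 0) :: real ^ 'm::{finite,linorder}) =
      elem_sym_map n (bar_point n (card S))"
    unfolding elem_sym_map_bar_point[OF k] by (rule elem_sym_map_uniform[OF S(1)])
  then have "\<forall>x\<in>prob_simplex n. ?f x \<le> ?f (bar_point n (card S))"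
    using S(3) by simp
  with k show ?thesis by blast
qed

lemma bar_point_in_prob_simplex:
  assumes "k \<in> {1..n}"
  shows "bar_point n k \<in> prob_simplex n"
proof -
  have sub: "{n - k<..n} \<subseteq> {1..n}" and card: "card {n - k<..n} = k"
    and ne: "{n - k<..n} \<noteq> {}" using assms by auto
  show ?thesis unfolding bar_point_eq by (rule uniform_in_prob_simplex[OF sub ne, unfolded card])
qed

lemma convex_hull_sym_image:
  assumes "1 \<le> n"
  shows "convex hull (sym_image n :: (real ^ 'm::{finite,linorder}) set) =
    convex hull ((\<lambda>k. elem_sym_map n (bar_point n k)) ` {1..n})" (is "_ = convex hull ?V")
proof
  show "convex hull ?V \<subseteq> convex hull sym_image n"
    by (rule hull_mono) (auto simp: sym_image_def bar_point_in_prob_simplex)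
  have "elem_sym_map n x \<in> convex hull ?V" if x: "x \<in> prob_simplex n" for x
  proof (rule ccontr)
    assume "elem_sym_map n x \<notin> convex hull ?V"
    moreover have "closed (convex hull ?V)"
      by (intro compact_imp_closed finite_imp_compact_convex_hull) simp
    ultimately obtain a b where ab: "a \<bullet> elem_sym_map n x < b" "\<And>y. y \<in> convex hull ?V \<Longrightarrow> b < a \<bullet> y"
      using separating_hyperplane_closed_point[OF convex_convex_hull] by metis
    \<comment> \<open>the separation puts the hull on the upper side of \<open>a\<close>, so the bound is needed for \<open>- a\<close>\<close>
    obtain k where k: "k \<in> {1..n}"
      "- a \<bullet> elem_sym_map n x \<le> - a \<bullet> elem_sym_map n (bar_point n k)"
      using linear_functional_max_at_bar_point[OF assms, of "- a"] x by blast
    have "elem_sym_map n (bar_point n k) \<in> convex hull ?V"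
      using k(1) by (intro hull_inc) auto
    then show False using ab k(2) by force
  qed
  then show "convex hull sym_image n \<subseteq> convex hull ?V"
    by (intro hull_minimal) (auto simp: sym_image_def)
qed

section \<open>The affine equivalence with the cyclic polytope\<close>

text \<open>
  Evaluated at \<open>1/k\<close> this is the \<open>i\<close>-th coordinate of the image of \<open>bar_point n k\<close>. It is kept as a
  polynomial because its coefficients are the entries of the affine map.
\<close>

definition bar_poly :: "nat \<Rightarrow> real poly" where
  "bar_poly i = smult (1 / fact (i + 1)) (\<Prod>r=1..i. [:1, - real r:])"

lemma degree_bar_poly: "degree (bar_poly i) = i"
  by (simp add: bar_poly_def degree_prod_eq_sum_degree)

text \<open>
  Each factor \<open>k - r\<close> of the falling factorial, divided by \<open>k\<close>, becomes \<open>1 - r/k\<close>. The factor with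
  \<open>r = 0\<close> is constant, and so \<open>e\<^sub>i\<^sub>+\<^sub>1\<close> yields degree \<open>i\<close>, matching the exponent \<open>i\<close> of the cyclic
  polytope.
\<close>

lemma poly_bar_poly:
  assumes "k \<noteq> 0"
  shows "poly (bar_poly i) (1 / real k) = real (k choose (i + 1)) * (1 / real k ^ (i + 1))"
proof -
  have "real (k choose (i + 1)) = (\<Prod>r = 0..<i + 1. real k - real r) / fact (i + 1)"
    by (simp add: binomial_gbinomial gbinomial_prod_rev)
  also have "(\<Prod>r = 0..<i + 1. real k - real r) = (\<Prod>r = 0..<i + 1. real k * (1 - real r / real k))"
    using assms by (intro prod.cong) (auto simp: field_simps)
  also have "\<dots> = real k ^ (i + 1) * (\<Prod>r = 0..<i + 1. 1 - real r / real k)"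
    by (simp add: prod.distrib)
  also have "(\<Prod>r = 0..<i + 1. 1 - real r / real k) = (\<Prod>r = 1..i. 1 - real r / real k)"
    by (rule prod.mono_neutral_right) auto
  finally show ?thesis
    using assms by (simp add: bar_poly_def poly_prod mult.commute)
qed

text \<open>
  Injectivity is forward substitution: the coordinates of a kernel element vanish one after the
  other, in the order given by \<open>coord_num\<close>. Surjectivity follows by dimension.
\<close>

lemma invertible_triangular_linear_map:
  fixes c :: "nat \<Rightarrow> nat \<Rightarrow> real"
  assumes lower: "\<And>i j. i < j \<Longrightarrow> c i j = 0" and diag: "\<And>i. c i i \<noteq> 0"
  defines "L \<equiv> (\<lambda>y. \<chi> i. \<Sum>j\<in>UNIV. c (coord_num i) (coord_num j) * y $ j) ::
    real ^ 'm::{finite,linorder} \<Rightarrow> real ^ 'm::{finite,linorder}"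
  shows "linear L" "bij L"
proof -
  show lin: "linear L"
    unfolding L_def
    by (intro linearI) (auto simp: vec_eq_iff algebra_simps sum.distrib sum_distrib_left)
  have inj_cn: "i = j" if "coord_num i = coord_num j" for i j :: 'm
    using bij_betw_coord_num[where 'm='m] that by (auto simp: bij_betw_def inj_def)
  have "y = 0" if y: "L y = 0" for y
  proof -
    have "\<forall>i::'m. coord_num i = k \<longrightarrow> y $ i = 0" for k
    proof (induction k rule: less_induct)
      case (less k)
      show ?case
      proof (intro allI impI)
        fix i :: 'm assume i: "coord_num i = k"
        have "0 = (\<Sum>j\<in>UNIV. c (coord_num i) (coord_num j) * y $ j)"
          using y by (simp add: L_def vec_eq_iff)
        also have "\<dots> = (\<Sum>j\<in>{i}. c (coord_num i) (coord_num j) * y $ j)"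
        proof (rule sum.mono_neutral_right)
          show "\<forall>j\<in>UNIV - {i}. c (coord_num i) (coord_num j) * y $ j = 0"
            using less i lower inj_cn by (metis DiffD2 linorder_neqE_nat mult_eq_0_iff singletonI)
        qed auto
        finally show "y $ i = 0" using diag by simp
      qed
    qed
    then show ?thesis by (simp add: vec_eq_iff)
  qed
  then have "inj L" using lin by (simp add: linear_injective_0)
  then show "bij L" using linear_injective_imp_surjective[OF lin] by (simp add: bij_def)
qed

text \<open>
  The coefficients of \<open>bar_poly i\<close> of positive degree form the \<open>i\<close>-th row of the linear part, and its
  constant coefficient is the \<open>i\<close>-th entry of the translation.
\<close>

lemma bar_points_affine_image:
  "\<exists>f :: real ^ 'm::{finite,linorder} \<Rightarrow> real ^ 'm::{finite,linorder}. invertible_affine_map f \<and>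
    (\<forall>k\<in>{1..n}. f (\<chi> i. 1 / real k ^ coord_num i) = elem_sym_map n (bar_point n k))"
proof -
  define c where "c i j = coeff (bar_poly i) j" for i j
  define L :: "real ^ 'm::{finite,linorder} \<Rightarrow> real ^ 'm::{finite,linorder}"
    where "L = (\<lambda>y. \<chi> i. \<Sum>j\<in>UNIV. c (coord_num i) (coord_num j) * y $ j)"
  define b :: "real ^ 'm::{finite,linorder}" where "b = (\<chi> i. c (coord_num i) 0)"
  have "c i j = 0" if "i < j" for i j
    using that by (simp add: c_def coeff_eq_0 degree_bar_poly)
  moreover have "c i i \<noteq> 0" for i
  proof -
    have "bar_poly i \<noteq> 0" by (auto simp: bar_poly_def)
    then show ?thesis using leading_coeff_neq_0[of "bar_poly i"] by (simp add: c_def degree_bar_poly)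
  qed
  ultimately have L: "linear L" "bij L"
    unfolding L_def using invertible_triangular_linear_map[of c] by auto
  have "L (\<chi> i. 1 / real k ^ coord_num i) + b = elem_sym_map n (bar_point n k)" if k: "k \<in> {1..n}" for k
  proof -
    have "(\<Sum>j\<in>UNIV. c (coord_num i) (coord_num (j::'m)) * (1 / real k ^ coord_num j)) + c (coord_num i) 0
        = poly (bar_poly (coord_num i)) (1 / real k)" for i :: 'm
    proof -
      have le: "coord_num i \<le> CARD('m)"
        using bij_betw_coord_num[where 'm='m] by (force simp: bij_betw_def)
      have "(\<Sum>j\<in>UNIV. c (coord_num i) (coord_num (j::'m)) * (1 / real k ^ coord_num j))
          = (\<Sum>j=1..CARD('m). c (coord_num i) j * (1 / real k ^ j))"
        by (rule sum.reindex_bij_betw[OF bij_betw_coord_num])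
      moreover have "{..CARD('m)} = insert 0 {1..CARD('m)}" by auto
      ultimately have "(\<Sum>j\<in>UNIV. c (coord_num i) (coord_num (j::'m)) * (1 / real k ^ coord_num j))
          + c (coord_num i) 0 = (\<Sum>j\<le>CARD('m). c (coord_num i) j * (1 / real k ^ j))"
        by simp
      also have "\<dots> = (\<Sum>j\<le>coord_num i. c (coord_num i) j * (1 / real k ^ j))"
        using le by (intro sum.mono_neutral_right) (auto simp: c_def coeff_eq_0 degree_bar_poly)
      finally show ?thesis
        by (simp add: poly_altdef degree_bar_poly c_def power_one_over)
    qed
    then show ?thesis
      using k poly_bar_poly[of k] unfolding elem_sym_map_bar_point[OF k]
      by (simp add: L_def b_def vec_eq_iff)
  qed
  moreover have "invertible_affine_map (\<lambda>y. L y + b)"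
    using L unfolding invertible_affine_map_def by blast
  ultimately show ?thesis by blast
qed

lemma convex_hull_invertible_affine_image:
  assumes "invertible_affine_map f"
  shows "convex hull (f ` S) = f ` (convex hull S)"
proof -
  obtain L b where L: "linear L" and f: "f = (\<lambda>x. L x + b)"
    using assms by (auto simp: invertible_affine_map_def)
  have "f ` T = (+) b ` L ` T" for T by (auto simp: f image_image add.commute)
  then show ?thesis
    by (simp only: convex_hull_translation convex_hull_linear_image[OF L])
qed

theorem theorem5p1:
  fixes n d :: nat
  assumes "3 \<le> d" and "d \<le> n" and "CARD('m::{finite,linorder}) = d - 1"
  shows "(\<exists>f :: real ^ 'm::{finite,linorder} \<Rightarrow> real ^ 'm::{finite,linorder}. invertible_affine_map f \<and>
            convex hull sym_image n = f ` cyclic_polytope n) \<and>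
         convex hull (sym_image n :: (real ^ 'm::{finite,linorder}) set) =
            convex hull ((\<lambda>k. elem_sym_map n (bar_point n k)) ` {1..n}) \<and>
         (\<forall>k\<in>{1..n}. (elem_sym_map n (bar_point n k) :: real ^ 'm::{finite,linorder}) =
            (\<chi> i. real (k choose (coord_num i + 1)) * (1 / real k ^ (coord_num i + 1))))"
proof (intro conjI ballI)
  have n: "1 \<le> n" using assms by simp
  show hull: "convex hull (sym_image n :: (real ^ 'm::{finite,linorder}) set) =
      convex hull ((\<lambda>k. elem_sym_map n (bar_point n k)) ` {1..n})"
    by (rule convex_hull_sym_image[OF n])
  obtain f :: "real ^ 'm::{finite,linorder} \<Rightarrow> real ^ 'm::{finite,linorder}" where f: "invertible_affine_map f"
    "\<And>k. k \<in> {1..n} \<Longrightarrow> f (\<chi> i. 1 / real k ^ coord_num i) = elem_sym_map n (bar_point n k)"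
    using bar_points_affine_image[of n] by blast
  have "f ` cyclic_polytope n = convex hull (f ` (\<lambda>k. \<chi> i. 1 / real k ^ coord_num i) ` {1..n})"
    by (simp only: cyclic_polytope_def convex_hull_invertible_affine_image[OF f(1)])
  also have "f ` (\<lambda>k. \<chi> i. 1 / real k ^ coord_num i) ` {1..n} =
      (\<lambda>k. elem_sym_map n (bar_point n k)) ` {1..n}"
    unfolding image_image by (intro image_cong refl f(2))
  finally show "\<exists>f :: real ^ 'm::{finite,linorder} \<Rightarrow> real ^ 'm::{finite,linorder}. invertible_affine_map f \<and>
      convex hull sym_image n = f ` cyclic_polytope n"
    using f(1) hull by metis
qed (rule elem_sym_map_bar_point)

end
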